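(* Let $X$ be a Banach lattice, $(\mathcal I_m)_{m\in\mathbb N}$ a sequence of proper ideals on $\mathbb N$, and $\mathcal I=\bigoplus_{m\in\mathbb N}\mathcal I_m$, an ideal on $\mathbb N\times\mathbb N$. Then $$\ell_\infty(X)/c_{0,\mathcal I}(X)\ \equiv_{\le}\ \ell_\infty\big((\ell_\infty(X)/c_{0,\mathcal I_m}(X))_{m\in\mathbb N}\big),$$ where on the left-hand side $\ell_\infty(X)$ is the space of bounded families in $X$ indexed by $\mathbb N\times\mathbb N$.
   Context: Banach lattices are real. An ideal on a countable set $F$ is a collection of subsets of $F$ containing $\emptyset$, closed under subsets and finite unions; every ideal is assumed to contain all finite sets; it is proper if it is not $\mathcal P(F)$. $\ell_\infty(X)$ (over $F$) is the Banach lattice of bounded families $(x_n)_{n\in F}$ in $X$ with sup norm and coordinatewise order, and $c_{0,\mathcal I}(X)$ is its closed subspace of all $(x_n)$ with $\{n\in F:\|x_n\|\ge\varepsilon\}\in\mathcal I$ for every $\varepsilon>0$; it is a closed lattice ideal, so quotients $\ell_\infty(X)/c_{0,\mathcal I}(X)$ are Banach lattices. The direct sum is $\bigoplus_m\mathcal I_m=\{A\subseteq\mathbb N\times\mathbb N: A_{(m)}\in\mathcal I_m\text{ for all }m\}$, where $A_{(m)}=\{n:(m,n)\in A\}$. For Banach lattices $(Z_m)$, $\ell_\infty((Z_m)_{m})$ is the Banach lattice of all bounded $(z_m)\in\prod_m Z_m$ with norm $\sup_m\|z_m\|$ and coordinatewise order. $E\equiv_{\le}G$ means there is a surjective linear isometry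 $E\to G$ that is a lattice isomorphism. *)

theory Defs
  imports "HOL-Analysis.Analysis"
begin

section \<open>Banach lattices\<close>

class banach_lattice = banach + ordered_real_vector + lattice +
  assumes norm_mono_modulus: "sup x (- x) \<le> sup y (- y) \<Longrightarrow> norm x \<le> norm y"

instance real :: banach_lattice
  by standard (auto simp: sup_real_def split: if_splits)

text \<open>
  Quotients, and products of a family of quotients by varying ideals, are not types. They are
  represented by explicit structures on a carrier set; the lattice operations are the suprema and
  infima of the order, taken in the carrier.
\<close>

record 'a blat =
  carr :: "'a set"
  add :: "'a \<Rightarrow> 'a \<Rightarrow> 'a"
  smul :: "real \<Rightarrow> 'a \<Rightarrow> 'a"
  nrm :: "'a \<Rightarrow> real"
  leq :: "'a \<Rightarrow> 'a \<Rightarrow> bool"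

definition is_join :: "'a blat \<Rightarrow> 'a \<Rightarrow> 'a \<Rightarrow> 'a \<Rightarrow> bool" where
  "is_join E x y z \<longleftrightarrow> z \<in> carr E \<and> leq E x z \<and> leq E y z \<and>
     (\<forall>w\<in>carr E. leq E x w \<longrightarrow> leq E y w \<longrightarrow> leq E z w)"

definition is_meet :: "'a blat \<Rightarrow> 'a \<Rightarrow> 'a \<Rightarrow> 'a \<Rightarrow> bool" where
  "is_meet E x y z \<longleftrightarrow> z \<in> carr E \<and> leq E z x \<and> leq E z y \<and>
     (\<forall>w\<in>carr E. leq E w x \<longrightarrow> leq E w y \<longrightarrow> leq E w z)"

definition linear_map :: "'a blat \<Rightarrow> 'b blat \<Rightarrow> ('a \<Rightarrow> 'b) \<Rightarrow> bool" where
  "linear_map E G T \<longleftrightarrow> T ` carr E \<subseteq> carr G \<and>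
     (\<forall>x\<in>carr E. \<forall>y\<in>carr E. T (add E x y) = add G (T x) (T y)) \<and>
     (\<forall>r. \<forall>x\<in>carr E. T (smul E r x) = smul G r (T x))"

text \<open>The equivalences say that both \<open>T\<close> and its inverse preserve binary suprema and infima.\<close>

definition lattice_iso :: "'a blat \<Rightarrow> 'b blat \<Rightarrow> ('a \<Rightarrow> 'b) \<Rightarrow> bool" where
  "lattice_iso E G T \<longleftrightarrow> bij_betw T (carr E) (carr G) \<and>
     (\<forall>x\<in>carr E. \<forall>y\<in>carr E. \<forall>z\<in>carr E.
        (is_join E x y z \<longleftrightarrow> is_join G (T x) (T y) (T z)) \<and>
        (is_meet E x y z \<longleftrightarrow> is_meet G (T x) (T y) (T z)))"

definition isometrically_lattice_isomorphic :: "'a blat \<Rightarrow> 'b blat \<Rightarrow> bool"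
    (infix "\<equiv>\<^sub>\<le>" 50) where
  "E \<equiv>\<^sub>\<le> G \<longleftrightarrow> (\<exists>T. linear_map E G T \<and> (\<forall>x\<in>carr E. nrm G (T x) = nrm E x) \<and>
     T ` carr E = carr G \<and> lattice_iso E G T)"

section \<open>Ideals of sets\<close>

definition set_ideal :: "'f set set \<Rightarrow> bool" where
  "set_ideal I \<longleftrightarrow> {} \<in> I \<and> (\<forall>A\<in>I. \<forall>B. B \<subseteq> A \<longrightarrow> B \<in> I) \<and>
     (\<forall>A\<in>I. \<forall>B\<in>I. A \<union> B \<in> I) \<and> (\<forall>A. finite A \<longrightarrow> A \<in> I)"

definition proper_set_ideal :: "'f set set \<Rightarrow> bool" where
  "proper_set_ideal I \<longleftrightarrow> set_ideal I \<and> I \<noteq> Pow UNIV"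

definition direct_sum_ideal :: "('m \<Rightarrow> 'f set set) \<Rightarrow> ('m \<times> 'f) set set" where
  "direct_sum_ideal I = {A. \<forall>m. {n. (m, n) \<in> A} \<in> I m}"

lemma set_ideal_direct_sum_ideal:
  assumes "\<And>m. set_ideal (I m)"
  shows "set_ideal (direct_sum_ideal I)"
proof -
  have un: "{n. (m, n) \<in> A \<or> (m, n) \<in> B} = {n. (m, n) \<in> A} \<union> {n. (m, n) \<in> B}"
    for m :: 'a and A B :: "('a \<times> 'b) set" by auto
  have fin: "finite {n. (m, n) \<in> A}" if "finite A" for m :: 'a and A :: "('a \<times> 'b) set"
    by (rule finite_subset[of _ "snd ` A"]) (use that in force)+
  have sub: "{n. (m, n) \<in> B} \<subseteq> {n. (m, n) \<in> A}" if "B \<subseteq> A"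
    for m :: 'a and A B :: "('a \<times> 'b) set" using that by auto
  show ?thesis
    using assms un fin sub unfolding set_ideal_def direct_sum_ideal_def
    by (simp, meson)
qed

section \<open>Spaces of bounded families and quotients\<close>

definition ell_infty :: "('f \<Rightarrow> 'x::banach_lattice) blat" where
  "ell_infty = \<lparr>carr = {x. bounded (range x)},
     add = (\<lambda>x y n. x n + y n),
     smul = (\<lambda>r x n. r *\<^sub>R x n),
     nrm = (\<lambda>x. SUP n. norm (x n)),
     leq = (\<lambda>x y. \<forall>n. x n \<le> y n)\<rparr>"

definition c0_ideal :: "'f set set \<Rightarrow> ('f \<Rightarrow> 'x::banach_lattice) set" where
  "c0_ideal I = {x \<in> carr ell_infty. \<forall>\<epsilon>>0. {n. norm (x n) \<ge> \<epsilon>} \<in> I}"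

definition ell_infty_sum :: "('m \<Rightarrow> 'z blat) \<Rightarrow> ('m \<Rightarrow> 'z) blat" where
  "ell_infty_sum Z = \<lparr>carr = {z. (\<forall>m. z m \<in> carr (Z m)) \<and> bdd_above (range (\<lambda>m. nrm (Z m) (z m)))},
     add = (\<lambda>z w m. add (Z m) (z m) (w m)),
     smul = (\<lambda>r z m. smul (Z m) r (z m)),
     nrm = (\<lambda>z. SUP m. nrm (Z m) (z m)),
     leq = (\<lambda>z w. \<forall>m. leq (Z m) (z m) (w m))\<rparr>"

text \<open>
  The quotient of \<open>E\<close> by \<open>N\<close> consists of cosets. Scalar multiples are re-saturated by \<open>N\<close>, since the
  pointwise multiple of a coset by \<open>0\<close> is only \<open>{0}\<close>. The order is the one whose positive cone is the
  image of the positive cone of \<open>E\<close>.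
\<close>

definition coset :: "'a blat \<Rightarrow> 'a set \<Rightarrow> 'a \<Rightarrow> 'a set" where
  "coset E N x = (\<lambda>z. add E x z) ` N"

definition quotient_blat :: "'a blat \<Rightarrow> 'a set \<Rightarrow> 'a set blat" where
  "quotient_blat E N = \<lparr>carr = coset E N ` carr E,
     add = (\<lambda>A B. {add E a b | a b. a \<in> A \<and> b \<in> B}),
     smul = (\<lambda>r A. \<Union>a\<in>A. coset E N (smul E r a)),
     nrm = (\<lambda>A. INF a\<in>A. nrm E a),
     leq = (\<lambda>A B. \<exists>a\<in>A. \<exists>b\<in>B. leq E a b)\<rparr>"

end

theory Submission
  imports Defs
begin

text \<open>
  Restricting a family on the product to its slices identifies \<open>c\<^sub>0\<close> of the direct sum with the bounded
  families all of whose slices lie in the respective \<open>c\<^sub>0\<close>, so it induces an injective linear map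
  between the quotients. Choosing for every slice a representative whose norm is within \<open>\<epsilon>\<close> of
  the quotient norm and gluing the slices together shows surjectivity and isometry. A coset of \<open>x\<close> lies
  below that of \<open>y\<close> iff the positive part of \<open>x - y\<close> is in \<open>c\<^sub>0\<close>; the positive part is automatically
  bounded, so this can also be checked by slices. Hence the map is an order isomorphism and therefore
  a lattice isomorphism.
\<close>

section \<open>Lattice norms and order isomorphisms\<close>

lemma sup_uminus_nonneg: "0 \<le> sup x (- x)" for x :: "'x::banach_lattice"
proof -
  have "x + (- x) \<le> sup x (- x) + sup x (- x)"
    by (intro add_mono) auto
  then have "0 \<le> (1/2::real) *\<^sub>R (sup x (- x) + sup x (- x))"
    by (intro scaleR_nonneg_nonneg) auto
  then show ?thesis
    by (simp add: scaleR_2 [symmetric])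
qed

lemma norm_mono_nonneg:
  fixes p w :: "'x::banach_lattice"
  assumes "0 \<le> p" "p \<le> sup w (- w)"
  shows "norm p \<le> norm w"
proof -
  have "- p \<le> p" using assms(1) by (meson neg_le_0_iff_le order_trans)
  then show ?thesis
    using assms(2) by (intro norm_mono_modulus) (simp add: sup_absorb1)
qed

text \<open>Both \<open>d\<close> and \<open>0\<close> lie below the modulus of \<open>w\<close>,
  hence so does their supremum. It is applied with \<open>d = x n - y n\<close> and \<open>w\<close>
  a difference of two null families.\<close>

lemma norm_pos_part_le:
  fixes d w :: "'x::banach_lattice"
  assumes "d \<le> w"
  shows "norm (sup d 0) \<le> norm w"
proof (rule norm_mono_nonneg)
  show "sup d 0 \<le> sup w (- w)"
    using assms sup_uminus_nonneg[of w] by (simp add: le_supI1)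
qed simp

text \<open>\<open>is_join\<close> and \<open>is_meet\<close> are expressed through
  \<open>carr\<close> and \<open>leq\<close> alone, so an order isomorphism of the carriers
  transports them in both directions.\<close>

lemma lattice_iso_order_iso:
  assumes bij: "bij_betw T (carr E) (carr G)"
    and ord: "\<And>x y. x \<in> carr E \<Longrightarrow> y \<in> carr E \<Longrightarrow> leq G (T x) (T y) \<longleftrightarrow> leq E x y"
  shows "lattice_iso E G T"
proof -
  have im: "carr G = T ` carr E" using bij by (simp add: bij_betw_def)
  show ?thesis
    unfolding lattice_iso_def is_join_def is_meet_def
    using bij by (auto simp: im ord)
qed

section \<open>Bounded families and their quotients\<close>

lemma carr_ell_inftyI: "(\<And>n. norm (x n) \<le> c) \<Longrightarrow> x \<in> carr ell_infty"
  by (auto simp: ell_infty_def bounded_iff)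

lemma norm_le_nrm_ell_infty: "x \<in> carr ell_infty \<Longrightarrow> norm (x n) \<le> nrm ell_infty x"
  by (auto simp: ell_infty_def bounded_iff bdd_above_def intro!: cSUP_upper)

lemma nrm_ell_infty_le: "(\<And>n. norm (x n) \<le> c) \<Longrightarrow> nrm ell_infty x \<le> c"
  by (auto simp: ell_infty_def intro!: cSUP_least)

lemma nrm_ell_infty_nonneg: "x \<in> carr ell_infty \<Longrightarrow> 0 \<le> nrm ell_infty x"
  using norm_le_nrm_ell_infty norm_ge_zero order_trans by meson

lemma add_ell_infty: "add ell_infty x y = (\<lambda>n. x n + y n)"
  and smul_ell_infty: "smul ell_infty r x = (\<lambda>n. r *\<^sub>R x n)"
  and leq_ell_infty: "leq ell_infty x y \<longleftrightarrow> (\<forall>n. x n \<le> y n)"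
  by (simp_all add: ell_infty_def)

lemma carr_ell_infty_add:
  assumes "x \<in> carr ell_infty" "y \<in> carr ell_infty"
  shows "(\<lambda>n. x n + y n) \<in> carr ell_infty"
  by (rule carr_ell_inftyI[of _ "nrm ell_infty x + nrm ell_infty y"])
    (use assms in \<open>auto intro!: norm_triangle_mono norm_le_nrm_ell_infty\<close>)

lemma carr_ell_infty_scaleR:
  assumes "x \<in> carr ell_infty"
  shows "(\<lambda>n. r *\<^sub>R x n) \<in> carr ell_infty"
  by (rule carr_ell_inftyI[of _ "\<bar>r\<bar> * nrm ell_infty x"])
    (use assms in \<open>auto intro!: mult_left_mono norm_le_nrm_ell_infty\<close>)

lemma carr_ell_infty_diff:
  assumes "x \<in> carr ell_infty" "y \<in> carr ell_infty"
  shows "(\<lambda>n. x n - y n) \<in> carr ell_infty"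
  using carr_ell_infty_add[OF assms(1) carr_ell_infty_scaleR[OF assms(2), of "-1"]] by simp

section \<open>Families that are null along an ideal of sets\<close>

lemma c0_ideal_carr: "x \<in> c0_ideal I \<Longrightarrow> x \<in> carr ell_infty"
  by (simp add: c0_ideal_def)

text \<open>Each level set of \<open>y\<close> is contained in that of \<open>x\<close>, and
  \<open>I\<close> is closed under subsets. Comparing norms only, it serves for negatives as well as
  for positive parts.\<close>

lemma c0_ideal_mono:
  assumes "set_ideal I" "x \<in> c0_ideal I" "\<And>n. norm (y n) \<le> norm (x n)"
  shows "y \<in> c0_ideal I"
proof -
  have "y \<in> carr ell_infty"
    by (rule carr_ell_inftyI[of _ "nrm ell_infty x"])
      (use assms(2,3) c0_ideal_carr norm_le_nrm_ell_infty order_trans in meson)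
  moreover have "{n. \<epsilon> \<le> norm (y n)} \<in> I" if "\<epsilon> > 0" for \<epsilon>
  proof -
    have "{n. \<epsilon> \<le> norm (y n)} \<subseteq> {n. \<epsilon> \<le> norm (x n)}"
      using assms(3) order_trans by blast
    moreover have "{n. \<epsilon> \<le> norm (x n)} \<in> I"
      using assms(2) that by (simp add: c0_ideal_def)
    ultimately show ?thesis using assms(1) unfolding set_ideal_def by blast
  qed
  ultimately show ?thesis by (simp add: c0_ideal_def)
qed

lemma c0_ideal_zero: "set_ideal I \<Longrightarrow> (\<lambda>n. 0) \<in> c0_ideal I"
  by (auto simp: c0_ideal_def set_ideal_def not_le intro: carr_ell_inftyI[of _ 0])

lemma c0_ideal_add:
  assumes I: "set_ideal I" and x: "x \<in> c0_ideal I" and y: "y \<in> c0_ideal I"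
  shows "(\<lambda>n. x n + y n) \<in> c0_ideal I"
proof -
  have "{n. \<epsilon> \<le> norm (x n + y n)} \<in> I" if "\<epsilon> > 0" for \<epsilon>
  proof -
    have "{n. \<epsilon> \<le> norm (x n + y n)} \<subseteq> {n. \<epsilon>/2 \<le> norm (x n)} \<union> {n. \<epsilon>/2 \<le> norm (y n)}"
    proof
      fix n assume "n \<in> {n. \<epsilon> \<le> norm (x n + y n)}"
      then show "n \<in> {n. \<epsilon>/2 \<le> norm (x n)} \<union> {n. \<epsilon>/2 \<le> norm (y n)}"
        using norm_triangle_ineq[of "x n" "y n"] by auto
    qed
    moreover have "{n. \<epsilon>/2 \<le> norm (x n)} \<in> I" "{n. \<epsilon>/2 \<le> norm (y n)} \<in> I"
      using x y half_gt_zero[OF that] unfolding c0_ideal_def by blast+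
    ultimately show ?thesis using I unfolding set_ideal_def by meson
  qed
  then show ?thesis
    using carr_ell_infty_add x y by (auto simp: c0_ideal_def)
qed

lemma c0_ideal_diff:
  assumes "set_ideal I" "x \<in> c0_ideal I" "y \<in> c0_ideal I"
  shows "(\<lambda>n. x n - y n) \<in> c0_ideal I"
proof -
  have "(\<lambda>n. - y n) \<in> c0_ideal I"
    using assms by (auto intro: c0_ideal_mono)
  then show ?thesis
    using c0_ideal_add[OF assms(1,2)] by fastforce
qed

section \<open>Cosets of null families, their order and their norm\<close>

lemma mem_coset_iff: "y \<in> coset ell_infty N x \<longleftrightarrow> (\<lambda>n. y n - x n) \<in> N"
proof
  assume "(\<lambda>n. y n - x n) \<in> N"
  moreover have "y = add ell_infty x (\<lambda>n. y n - x n)" by (simp add: add_ell_infty)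
  ultimately show "y \<in> coset ell_infty N x" unfolding coset_def by blast
qed (auto simp: coset_def add_ell_infty)

lemma self_mem_coset: "set_ideal I \<Longrightarrow> x \<in> coset ell_infty (c0_ideal I) x"
  by (simp add: mem_coset_iff c0_ideal_zero)

lemma coset_carr:
  assumes "x \<in> carr ell_infty" "y \<in> coset ell_infty (c0_ideal I) x"
  shows "y \<in> carr ell_infty"
  using carr_ell_infty_add[OF assms(1) c0_ideal_carr[OF assms(2)[unfolded mem_coset_iff]]] by simp

lemma coset_eq_iff:
  assumes I: "set_ideal I"
  shows "coset ell_infty (c0_ideal I) x = coset ell_infty (c0_ideal I) y \<longleftrightarrow>
    (\<lambda>n. x n - y n) \<in> c0_ideal I"
proof
  assume "coset ell_infty (c0_ideal I) x = coset ell_infty (c0_ideal I) y"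
  then show "(\<lambda>n. x n - y n) \<in> c0_ideal I"
    using self_mem_coset[OF I] mem_coset_iff by blast
next
  assume d: "(\<lambda>n. x n - y n) \<in> c0_ideal I"
  \<comment> \<open>Here \<open>w - y = (w - x) + (x - y)\<close> and
    \<open>w - x = (w - y) - (x - y)\<close>.\<close>
  have "(\<lambda>n. w n - x n) \<in> c0_ideal I \<longleftrightarrow> (\<lambda>n. w n - y n) \<in> c0_ideal I" for w
    using c0_ideal_add[OF I _ d, of "\<lambda>n. w n - x n"] c0_ideal_diff[OF I _ d, of "\<lambda>n. w n - y n"]
    by auto
  then show "coset ell_infty (c0_ideal I) x = coset ell_infty (c0_ideal I) y"
    by (simp add: set_eq_iff mem_coset_iff)
qed

text \<open>If \<open>a \<le> b\<close> are representatives, then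
  \<open>x - y \<le> (b - y) - (a - x)\<close>, whose right side is null, so the positive part of
  \<open>x - y\<close> is null by domination. Conversely, adding a null positive part to
  \<open>y\<close> keeps its coset and gives a representative above \<open>x\<close>.\<close>

lemma leq_quotient_iff:
  assumes I: "set_ideal I"
  shows "leq (quotient_blat ell_infty (c0_ideal I))
      (coset ell_infty (c0_ideal I) x) (coset ell_infty (c0_ideal I) y) \<longleftrightarrow>
    (\<lambda>n. sup (x n - y n) 0) \<in> c0_ideal I" (is "?L \<longleftrightarrow> ?R")
proof
  assume ?L
  then obtain a b where a: "(\<lambda>n. a n - x n) \<in> c0_ideal I" and b: "(\<lambda>n. b n - y n) \<in> c0_ideal I"
    and ab: "\<And>n. a n \<le> b n"
    by (auto simp: quotient_blat_def mem_coset_iff leq_ell_infty)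
  have "norm (sup (x n - y n) 0) \<le> norm ((b n - y n) - (a n - x n))" for n
    using ab[of n] by (intro norm_pos_part_le) (simp add: algebra_simps)
  then show ?R by (rule c0_ideal_mono[OF I c0_ideal_diff[OF I b a]])
next
  assume ?R
  then have "(\<lambda>n. y n + sup (x n - y n) 0) \<in> coset ell_infty (c0_ideal I) y"
    by (simp add: mem_coset_iff)
  moreover have "x n \<le> y n + sup (x n - y n) 0" for n
    by (metis add.commute diff_le_eq sup.cobounded1)
  ultimately show ?L
    unfolding quotient_blat_def blat.simps leq_ell_infty
    by (intro bexI[where x = x] bexI[where x = "\<lambda>n. y n + sup (x n - y n) 0"]
        self_mem_coset[OF I]) auto
qed

lemma carr_quotient: "carr (quotient_blat E N) = coset E N ` carr E"
  by (simp add: quotient_blat_def)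

lemma nrm_quotient: "nrm (quotient_blat E N) A = (INF a\<in>A. nrm E a)"
  by (simp add: quotient_blat_def)

lemma bdd_below_coset_nrm:
  assumes "x \<in> carr ell_infty"
  shows "bdd_below (nrm ell_infty ` coset ell_infty (c0_ideal I) x)"
  using coset_carr[OF assms] nrm_ell_infty_nonneg by (intro bdd_belowI2[of _ 0]) auto

lemma nrm_quotient_le:
  assumes "x \<in> carr ell_infty" "a \<in> coset ell_infty (c0_ideal I) x"
  shows "nrm (quotient_blat ell_infty (c0_ideal I)) (coset ell_infty (c0_ideal I) x)
    \<le> nrm ell_infty a"
  unfolding nrm_quotient by (intro cINF_lower bdd_below_coset_nrm assms)

lemma nrm_quotient_ge:
  assumes "set_ideal I" "\<And>a. a \<in> coset ell_infty (c0_ideal I) x \<Longrightarrow> c \<le> nrm ell_infty a"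
  shows "c \<le> nrm (quotient_blat ell_infty (c0_ideal I)) (coset ell_infty (c0_ideal I) x)"
  unfolding nrm_quotient using self_mem_coset[OF assms(1)] assms(2) by (intro cINF_greatest) auto

lemma nrm_quotient_approx:
  assumes "set_ideal I" "x \<in> carr ell_infty" "\<epsilon> > 0"
  obtains a where "a \<in> coset ell_infty (c0_ideal I) x"
    "nrm ell_infty a
      < nrm (quotient_blat ell_infty (c0_ideal I)) (coset ell_infty (c0_ideal I) x) + \<epsilon>"
proof -
  have "(INF a\<in>coset ell_infty (c0_ideal I) x. nrm ell_infty a) <
      nrm (quotient_blat ell_infty (c0_ideal I)) (coset ell_infty (c0_ideal I) x) + \<epsilon>"
    using assms(3) by (simp add: nrm_quotient)
  then show thesis
    using self_mem_coset[OF assms(1)] bdd_below_coset_nrm[OF assms(2)] that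
    by (subst (asm) cINF_less_iff) auto
qed

section \<open>Rows of a family on a product\<close>

definition slice :: "'m \<Rightarrow> ('m \<times> 'f \<Rightarrow> 'x) \<Rightarrow> 'f \<Rightarrow> 'x" where
  "slice m x = (\<lambda>n. x (m, n))"

lemma slice_case_prod [simp]: "slice m (\<lambda>(k, n). y k n) = y m"
  by (simp add: slice_def)

lemma slice_carr:
  assumes "x \<in> carr ell_infty"
  shows "slice m x \<in> carr ell_infty"
  using norm_le_nrm_ell_infty[OF assms] by (auto simp: slice_def intro: carr_ell_inftyI)

lemma nrm_slice_le:
  assumes "x \<in> carr ell_infty"
  shows "nrm ell_infty (slice m x) \<le> nrm ell_infty x"
  using norm_le_nrm_ell_infty[OF assms] by (auto simp: slice_def intro: nrm_ell_infty_le)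

text \<open>The common bound \<open>c\<close> matters: slices that are merely bounded one by one can
  glue to an unbounded family.\<close>

lemma glue_bound:
  assumes "\<And>m. y m \<in> carr ell_infty" "\<And>m. nrm ell_infty (y m) \<le> c"
  shows "(\<lambda>(m, n). y m n) \<in> carr ell_infty" "nrm ell_infty (\<lambda>(m, n). y m n) \<le> c"
proof -
  have "norm (case p of (m, n) \<Rightarrow> y m n) \<le> c" for p
    using norm_le_nrm_ell_infty[OF assms(1)] assms(2) order_trans by (fastforce split: prod.split)
  then show "(\<lambda>(m, n). y m n) \<in> carr ell_infty" "nrm ell_infty (\<lambda>(m, n). y m n) \<le> c"
    by (blast intro: carr_ell_inftyI nrm_ell_infty_le)+
qed

text \<open>The row at \<open>m\<close> of a level set of \<open>z\<close> is the level set of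
  \<open>slice m z\<close>, so the two universal quantifiers can be exchanged. Boundedness of
  \<open>z\<close> remains a separate conjunct, since it does not follow from boundedness of each
  slice.\<close>

lemma c0_direct_sum_iff:
  "z \<in> c0_ideal (direct_sum_ideal I) \<longleftrightarrow>
    z \<in> carr ell_infty \<and> (\<forall>m. slice m z \<in> c0_ideal (I m))"
  using slice_carr by (auto simp: c0_ideal_def direct_sum_ideal_def slice_def)

text \<open>Equality, not just inclusion, is what makes the slices of a coset a full coset. The
  reverse inclusion extends \<open>w\<close> by zero to the other rows.\<close>

lemma slice_image_c0:
  assumes "\<And>m. set_ideal (I m)"
  shows "slice m ` c0_ideal (direct_sum_ideal I) = c0_ideal (I m)"
proof
  show "c0_ideal (I m) \<subseteq> slice m ` c0_ideal (direct_sum_ideal I)"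
  proof
    fix w :: "_ \<Rightarrow> 'x::banach_lattice" assume w: "w \<in> c0_ideal (I m)"
    let ?y = "\<lambda>k. if k = m then w else (\<lambda>n. 0)"
    have y: "?y k \<in> c0_ideal (I k)" for k
      using w c0_ideal_zero[OF assms] by auto
    have "nrm ell_infty (?y k) \<le> nrm ell_infty w" for k
      using nrm_ell_infty_nonneg[OF c0_ideal_carr[OF w]] by (auto intro: nrm_ell_infty_le)
    then have "(\<lambda>(k, n). ?y k n) \<in> carr ell_infty"
      using c0_ideal_carr[OF y] by (intro glue_bound)
    then have "(\<lambda>(k, n). ?y k n) \<in> c0_ideal (direct_sum_ideal I)"
      using y by (simp only: c0_direct_sum_iff slice_case_prod) simp
    moreover have "slice m (\<lambda>(k, n). ?y k n) = w" by (subst slice_case_prod) simp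
    ultimately show "w \<in> slice m ` c0_ideal (direct_sum_ideal I)" by (metis imageI)
  qed
qed (auto simp: c0_direct_sum_iff)

text \<open>Acting on sets of families by images avoids choosing representatives, so
  well-definedness on cosets is automatic.\<close>

definition slices :: "('m \<times> 'f \<Rightarrow> 'x) set \<Rightarrow> 'm \<Rightarrow> ('f \<Rightarrow> 'x) set" where
  "slices A m = slice m ` A"

section \<open>The slicing map between the quotients\<close>

context
  fixes I :: "'m \<Rightarrow> 'f set set"
    and Q :: "('m \<times> 'f \<Rightarrow> 'x::banach_lattice) set blat"
    and Z :: "'m \<Rightarrow> ('f \<Rightarrow> 'x) set blat"
    and C :: "('m \<times> 'f \<Rightarrow> 'x) \<Rightarrow> ('m \<times> 'f \<Rightarrow> 'x) set"
    and D :: "'m \<Rightarrow> ('f \<Rightarrow> 'x) \<Rightarrow> ('f \<Rightarrow> 'x) set"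
  defines "Q \<equiv> quotient_blat ell_infty (c0_ideal (direct_sum_ideal I))"
    and "Z \<equiv> \<lambda>m. quotient_blat ell_infty (c0_ideal (I m))"
    and "C \<equiv> coset ell_infty (c0_ideal (direct_sum_ideal I))"
    and "D \<equiv> \<lambda>m. coset ell_infty (c0_ideal (I m))"
  assumes ideals: "\<And>m. set_ideal (I m)"
begin

lemmas ideal_sum = set_ideal_direct_sum_ideal[of I, OF ideals]

text \<open>Slicing is additive and maps the null families of the direct sum onto those of
  \<open>I m\<close>, so it carries translates to translates.\<close>

lemma slices_coset: "slices (C x) m = D m (slice m x)"
proof -
  have "slices (C x) m = (\<lambda>z. add ell_infty (slice m x) z) ` slice m ` c0_ideal (direct_sum_ideal I)"
    by (simp add: slices_def C_def coset_def image_image add_ell_infty slice_def)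
  then show ?thesis
    by (simp add: slice_image_c0[OF ideals] D_def coset_def)
qed

text \<open>Boundedness of \<open>x\<close> and \<open>a\<close> settles the boundedness conjunct of
  \<open>c0_direct_sum_iff\<close> for their difference, leaving only the condition on the
  slices.\<close>

lemma mem_coset_sum_iff:
  assumes "x \<in> carr ell_infty" "a \<in> carr ell_infty"
  shows "a \<in> C x \<longleftrightarrow> (\<forall>m. slice m a \<in> D m (slice m x))"
  using carr_ell_infty_diff[OF assms(2,1)]
  by (simp add: C_def D_def mem_coset_iff c0_direct_sum_iff slice_def)

text \<open>Slicing a representative of \<open>C x\<close> yields a representative of the row coset
  of no larger norm; then pass to the infimum.\<close>

lemma nrm_slices_le:
  assumes x: "x \<in> carr ell_infty"
  shows "nrm (Z m) (slices (C x) m) \<le> nrm Q (C x)"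
  unfolding Q_def C_def
proof (rule nrm_quotient_ge[OF ideal_sum])
  fix a assume a: "a \<in> coset ell_infty (c0_ideal (direct_sum_ideal I)) x"
  have ac: "a \<in> carr ell_infty" by (rule coset_carr[OF x a])
  have "slice m a \<in> D m (slice m x)"
    using a mem_coset_sum_iff[OF x ac] by (simp add: C_def)
  then have "nrm (Z m) (D m (slice m x)) \<le> nrm ell_infty (slice m a)"
    unfolding Z_def D_def by (intro nrm_quotient_le slice_carr x)
  also have "\<dots> \<le> nrm ell_infty a" by (rule nrm_slice_le[OF ac])
  finally show "nrm (Z m) (slices (coset ell_infty (c0_ideal (direct_sum_ideal I)) x) m)
      \<le> nrm ell_infty a"
    using slices_coset by (simp add: C_def)
qed

lemma slices_in_sum:
  assumes x: "x \<in> carr ell_infty"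
  shows "slices (C x) \<in> carr (ell_infty_sum Z)"
  using nrm_slices_le[OF x] slice_carr[OF x]
  by (auto simp: ell_infty_sum_def bdd_above_def slices_coset Z_def carr_quotient D_def)

lemma nrm_slices:
  assumes x: "x \<in> carr ell_infty"
  shows "nrm (ell_infty_sum Z) (slices (C x)) = nrm Q (C x)"
proof (rule antisym)
  let ?s = "nrm (ell_infty_sum Z) (slices (C x))"
  show "?s \<le> nrm Q (C x)"
    using nrm_slices_le[OF x] by (auto simp: ell_infty_sum_def intro: cSUP_least)
  have le_s: "nrm (Z m) (D m (slice m x)) \<le> ?s" for m
    using slices_in_sum[OF x] by (auto simp: ell_infty_sum_def slices_coset intro: cSUP_upper)
  show "nrm Q (C x) \<le> ?s"
  proof (rule field_le_epsilon)
    fix \<epsilon> :: real assume "\<epsilon> > 0"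
    \<comment> \<open>One \<open>\<epsilon>\<close> serves all rows, so the near-optimal row
      representatives share the bound \<open>?s + \<epsilon>\<close> and glue to a representative of
      \<open>C x\<close> with that bound.\<close>
    then have "\<forall>m. \<exists>a. a \<in> D m (slice m x) \<and> nrm ell_infty a < nrm (Z m) (D m (slice m x)) + \<epsilon>"
      unfolding Z_def D_def by (metis nrm_quotient_approx[OF ideals slice_carr[OF x]])
    then obtain a where a: "\<And>m. a m \<in> D m (slice m x)"
      and na: "\<And>m. nrm ell_infty (a m) < nrm (Z m) (D m (slice m x)) + \<epsilon>"
      by metis
    have ac: "a m \<in> carr ell_infty" for m
      using a slice_carr[OF x] coset_carr unfolding D_def by blast
    have "nrm ell_infty (a m) \<le> ?s + \<epsilon>" for m
      using na[of m] le_s[of m] by linarith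
    note glue = glue_bound[of a, OF ac this]
    have "(\<lambda>(m, n). a m n) \<in> C x"
      using a by (simp add: mem_coset_sum_iff[OF x glue(1)])
    then have "nrm Q (C x) \<le> nrm ell_infty (\<lambda>(m, n). a m n)"
      unfolding Q_def C_def by (rule nrm_quotient_le[OF x])
    then show "nrm Q (C x) \<le> ?s + \<epsilon>" using glue(2) by linarith
  qed
qed

lemma slices_surj:
  assumes z: "z \<in> carr (ell_infty_sum Z)"
  obtains x where "x \<in> carr ell_infty" "slices (C x) = z"
proof -
  obtain c where c: "\<And>m. nrm (Z m) (z m) \<le> c"
    using z by (auto simp: ell_infty_sum_def bdd_above_def)
  \<comment> \<open>Arbitrary representatives of the \<open>z m\<close> need not be uniformly
    bounded. Near-optimal ones with the fixed slack 1 are, which permits gluing.\<close>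
  have "\<exists>a. a \<in> carr ell_infty \<and> z m = D m a \<and> nrm ell_infty a \<le> c + 1" for m
  proof -
    obtain y where y: "y \<in> carr ell_infty" "z m = D m y"
      using z by (auto simp: ell_infty_sum_def Z_def carr_quotient D_def)
    obtain a where a: "a \<in> D m y" "nrm ell_infty a < nrm (Z m) (D m y) + 1"
      unfolding Z_def D_def using nrm_quotient_approx[OF ideals y(1) zero_less_one] by blast
    have "a \<in> carr ell_infty" using a(1) y(1) coset_carr unfolding D_def by blast
    moreover have "D m a = D m y"
      using a(1) unfolding D_def coset_eq_iff[OF ideals] by (simp add: mem_coset_iff)
    moreover have "nrm ell_infty a \<le> c + 1" using a(2) c[of m] y(2) by simp
    ultimately show ?thesis using y(2) by auto
  qed
  then obtain a where a: "\<And>m. a m \<in> carr ell_infty" "\<And>m. z m = D m (a m)"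
    "\<And>m. nrm ell_infty (a m) \<le> c + 1"
    by metis
  show thesis
  proof (rule that)
    show "(\<lambda>(m, n). a m n) \<in> carr ell_infty" by (rule glue_bound(1)[OF a(1,3)])
    show "slices (C (\<lambda>(m, n). a m n)) = z"
      using a(2) by (auto simp: slices_coset)
  qed
qed

lemma leq_slices_iff:
  assumes x: "x \<in> carr ell_infty" and y: "y \<in> carr ell_infty"
  shows "leq (ell_infty_sum Z) (slices (C x)) (slices (C y)) \<longleftrightarrow> leq Q (C x) (C y)"
proof -
  let ?p = "\<lambda>k. sup (x k - y k) 0"
  have d: "(\<lambda>k. x k - y k) \<in> carr ell_infty" by (rule carr_ell_infty_diff[OF x y])
  \<comment> \<open>This provides the boundedness conjunct of \<open>c0_direct_sum_iff\<close>,
    after which both order relations reduce to the same condition on the slices of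
    \<open>?p\<close>.\<close>
  have "norm (?p k) \<le> nrm ell_infty (\<lambda>k. x k - y k)" for k
    using norm_pos_part_le[OF order_refl] norm_le_nrm_ell_infty[OF d] order_trans by blast
  then have "?p \<in> carr ell_infty" by (rule carr_ell_inftyI)
  then show ?thesis
    by (simp add: Q_def C_def leq_quotient_iff[OF ideal_sum] c0_direct_sum_iff
        ell_infty_sum_def slices_coset[unfolded C_def] Z_def D_def leq_quotient_iff[OF ideals] slice_def)
qed

lemma linear_map_slices: "linear_map Q (ell_infty_sum Z) slices"
proof -
  have carr: "carr Q = C ` carr ell_infty" by (simp add: Q_def C_def carr_quotient)
  \<comment> \<open>This holds for arbitrary sets \<open>A\<close> and \<open>B\<close>: addition in
    the quotients is elementwise, and slicing is additive on elements.\<close>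
  have "slices (add Q A B) = add (ell_infty_sum Z) (slices A) (slices B)" for A B
  proof
    fix m
    have "slice m (add ell_infty a b) = add ell_infty (slice m a) (slice m b)"
      for a b :: "'m \<times> 'f \<Rightarrow> 'x"
      by (simp add: slice_def add_ell_infty)
    then show "slices (add Q A B) m = add (ell_infty_sum Z) (slices A) (slices B) m"
      unfolding Q_def Z_def quotient_blat_def ell_infty_sum_def slices_def
      by (auto simp: image_iff) metis+
  qed
  moreover have "slices (smul Q r A) = smul (ell_infty_sum Z) r (slices A)" for r A
  proof
    fix m
    \<comment> \<open>A scalar multiple is a union of cosets. Images commute with unions, so it
      suffices that each of these cosets is sliced to the corresponding row coset.\<close>
    have "slice m ` C (smul ell_infty r a) = D m (smul ell_infty r (slice m a))" for a
      using slices_coset[of "smul ell_infty r a" m] by (simp add: slices_def slice_def smul_ell_infty)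
    then show "slices (smul Q r A) m = smul (ell_infty_sum Z) r (slices A) m"
      by (simp add: Q_def Z_def quotient_blat_def ell_infty_sum_def slices_def image_UN
          C_def D_def)
  qed
  ultimately show ?thesis
    using slices_in_sum by (auto simp: linear_map_def carr)
qed

lemma bij_betw_slices: "bij_betw slices (carr Q) (carr (ell_infty_sum Z))"
proof (rule bij_betw_imageI)
  have carr: "carr Q = C ` carr ell_infty" by (simp add: Q_def C_def carr_quotient)
  show "slices ` carr Q = carr (ell_infty_sum Z)"
  proof
    show "slices ` carr Q \<subseteq> carr (ell_infty_sum Z)"
      using slices_in_sum by (auto simp: carr)
    show "carr (ell_infty_sum Z) \<subseteq> slices ` carr Q"
    proof
      fix z assume "z \<in> carr (ell_infty_sum Z)"
      then obtain x where "x \<in> carr ell_infty" "slices (C x) = z" by (rule slices_surj)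
      then show "z \<in> slices ` carr Q" by (auto simp: carr)
    qed
  qed
  show "inj_on slices (carr Q)"
  proof (rule inj_onI)
    fix A B assume "A \<in> carr Q" "B \<in> carr Q" and eq: "slices A = slices B"
    then obtain x y where x: "x \<in> carr ell_infty" "A = C x" and y: "y \<in> carr ell_infty" "B = C y"
      by (auto simp: carr)
    \<comment> \<open>Each slice of \<open>x\<close> lies in its own row coset, which by
      \<open>eq\<close> is that of \<open>y\<close>; the row memberships then combine to
      \<open>x \<in> C y\<close>.\<close>
    have "slice m x \<in> D m (slice m y)" for m
      using fun_cong[OF eq, of m] self_mem_coset[OF ideals, of "slice m x" m]
      unfolding x(2) y(2) slices_coset D_def by simp
    then have "x \<in> C y" by (simp add: mem_coset_sum_iff[OF y(1) x(1)])
    then show "A = B"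
      unfolding x(2) y(2) C_def coset_eq_iff[OF ideal_sum] by (simp add: mem_coset_iff)
  qed
qed

lemma quotient_direct_sum_iso: "Q \<equiv>\<^sub>\<le> ell_infty_sum Z"
proof -
  have carr: "carr Q = C ` carr ell_infty" by (simp add: Q_def C_def carr_quotient)
  have "lattice_iso Q (ell_infty_sum Z) slices"
    by (rule lattice_iso_order_iso[OF bij_betw_slices]) (auto simp: carr leq_slices_iff)
  moreover have "\<forall>A\<in>carr Q. nrm (ell_infty_sum Z) (slices A) = nrm Q A"
    by (auto simp: carr nrm_slices)
  ultimately show ?thesis
    unfolding isometrically_lattice_isomorphic_def
    using linear_map_slices bij_betw_imp_surj_on[OF bij_betw_slices] by blast
qed

end

theorem theorem8p3:
  fixes I :: "nat \<Rightarrow> nat set set"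
  assumes "\<And>m. proper_set_ideal (I m)"
  shows "quotient_blat (ell_infty :: (nat \<times> nat \<Rightarrow> 'x::banach_lattice) blat)
           (c0_ideal (direct_sum_ideal I)) \<equiv>\<^sub>\<le>
         ell_infty_sum (\<lambda>m. quotient_blat (ell_infty :: (nat \<Rightarrow> 'x) blat) (c0_ideal (I m)))"
  using assms by (intro quotient_direct_sum_iso) (simp add: proper_set_ideal_def)

end
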